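(* The three intervals $[\mathsf{LP}\cap\mathsf{ECQ},\mathsf{LP}]$, $[\mathsf{ECQ},\mathsf{LP}\vee\mathsf{ECQ}]$ and $[\mathsf{ETL},\mathsf{CL}]$ are pairwise disjoint, and every non-trivial proper extension of $\mathsf{BD}$ lies in one of them.
   Context: Formulas are built from a countably infinite set of propositional variables using binary $\wedge,\vee$, unary ${\sim}$ (De Morgan negation) and constants $\top,\bot$. A logic is a set of rules $\Gamma\vdash\varphi$ ($\Gamma$ a set of formulas) closed under reflexivity, monotonicity, cut and substitution. $L_1\le L_2$ means $L_1\subseteq L_2$; an extension of $L$ is a logic containing $L$; the extension of $L$ by a set of rules is the least logic containing both; $L_1\vee L_2$ is the least logic containing $L_1\cup L_2$; the trivial logic contains all rules; $[L_1,L_2]$ is the set of logics $L$ with $L_1\le L\le L_2$. A matrix $\langle A,F\rangle$ is an algebra of this signature with $F\subseteq A$; a rule $\Gamma\vdash\varphi$ is valid in it if every valuation (homomorphism from formulas into $A$) sending $\Gamma$ into $F$ sends $\varphi$ into $F$; $\mathrm{Log}\,\mathbf A$ is the set of rules valid in $\mathbf A$. Let $\mathbf{DM}_4$ be the De Morgan algebra on $\{\bot,n,b,\top\}$ with $\bot<n,b<\top$ ($n,b$ incomparable), ${\sim}\top=\bot$, ${\sim}\bot=\top$, ${\sim}n=n$, ${\sim}b=b$. Let $\mathbf{BD}_4=\langle\mathbf{DM}_4,\{b,\top\}\rangle$, $\mathbf{ETL}_4=\langle\mathbf{DM}_4,\{\top\}\rangle$, $\mathbf{LP}_3$ the submatrix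 of $\mathbf{BD}_4$ on $\{\bot,b,\top\}$ (designated $\{b,\top\}$), $\mathbf{B}_2$ the submatrix of $\mathbf{ETL}_4$ on $\{\bot,\top\}$ (designated $\{\top\}$). $\mathsf{BD}=\mathrm{Log}\,\mathbf{BD}_4$, $\mathsf{ETL}=\mathrm{Log}\,\mathbf{ETL}_4$, $\mathsf{LP}=\mathrm{Log}\,\mathbf{LP}_3$, $\mathsf{CL}=\mathrm{Log}\,\mathbf{B}_2$. $\mathsf{ECQ}$ is the extension of $\mathsf{BD}$ by the rule $p,{\sim}p\vdash q$ ($p,q$ distinct variables). *)

theory Defs
  imports Main
begin

datatype fm =
    Var nat
  | Conj fm fm
  | Disj fm fm
  | Neg fm
  | Top
  | Bot

primrec subst :: "(nat \<Rightarrow> fm) \<Rightarrow> fm \<Rightarrow> fm" where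
  "subst \<sigma> (Var i) = \<sigma> i"
| "subst \<sigma> (Conj \<phi> \<psi>) = Conj (subst \<sigma> \<phi>) (subst \<sigma> \<psi>)"
| "subst \<sigma> (Disj \<phi> \<psi>) = Disj (subst \<sigma> \<phi>) (subst \<sigma> \<psi>)"
| "subst \<sigma> (Neg \<phi>) = Neg (subst \<sigma> \<phi>)"
| "subst \<sigma> Top = Top"
| "subst \<sigma> Bot = Bot"

text \<open>The pair \<open>(\<Gamma>, \<phi>)\<close> is the rule \<open>\<Gamma> \<turnstile> \<phi>\<close>; the premise set \<open>\<Gamma>\<close> may be infinite.\<close>

type_synonym rule = "fm set \<times> fm"

definition is_logic :: "rule set \<Rightarrow> bool" where
  "is_logic L \<longleftrightarrow>
     (\<forall>\<Gamma> \<phi>. \<phi> \<in> \<Gamma> \<longrightarrow> (\<Gamma>, \<phi>) \<in> L) \<and>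
     (\<forall>\<Gamma> \<Delta> \<phi>. (\<Gamma>, \<phi>) \<in> L \<and> \<Gamma> \<subseteq> \<Delta> \<longrightarrow> (\<Delta>, \<phi>) \<in> L) \<and>
     (\<forall>\<Gamma> \<Delta> \<phi>. (\<forall>\<psi>\<in>\<Delta>. (\<Gamma>, \<psi>) \<in> L) \<and> (\<Gamma> \<union> \<Delta>, \<phi>) \<in> L \<longrightarrow> (\<Gamma>, \<phi>) \<in> L) \<and>
     (\<forall>\<Gamma> \<phi> \<sigma>. (\<Gamma>, \<phi>) \<in> L \<longrightarrow> (subst \<sigma> ` \<Gamma>, subst \<sigma> \<phi>) \<in> L)"

definition least_logic :: "rule set \<Rightarrow> rule set" where
  "least_logic R = \<Inter> {L. is_logic L \<and> R \<subseteq> L}"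

definition is_extension :: "rule set \<Rightarrow> rule set \<Rightarrow> bool" where
  "is_extension L L' \<longleftrightarrow> is_logic L' \<and> L \<subseteq> L'"

definition extension_by :: "rule set \<Rightarrow> rule set \<Rightarrow> rule set" where
  "extension_by L R = least_logic (L \<union> R)"

definition logic_join :: "rule set \<Rightarrow> rule set \<Rightarrow> rule set" where
  "logic_join L1 L2 = least_logic (L1 \<union> L2)"

definition logic_interval :: "rule set \<Rightarrow> rule set \<Rightarrow> rule set set" where
  "logic_interval L1 L2 = {L. is_logic L \<and> L1 \<subseteq> L \<and> L \<subseteq> L2}"

definition trivial_logic :: "rule set" where
  "trivial_logic = UNIV"

record 'a matrix =
  universe :: "'a set"
  meet :: "'a \<Rightarrow> 'a \<Rightarrow> 'a"
  join :: "'a \<Rightarrow> 'a \<Rightarrow> 'a"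
  neg :: "'a \<Rightarrow> 'a"
  tt :: 'a
  ff :: 'a
  designated :: "'a set"

definition is_valuation :: "'a matrix \<Rightarrow> (fm \<Rightarrow> 'a) \<Rightarrow> bool" where
  "is_valuation A h \<longleftrightarrow>
     (\<forall>\<phi>. h \<phi> \<in> universe A) \<and>
     (\<forall>\<phi> \<psi>. h (Conj \<phi> \<psi>) = meet A (h \<phi>) (h \<psi>)) \<and>
     (\<forall>\<phi> \<psi>. h (Disj \<phi> \<psi>) = join A (h \<phi>) (h \<psi>)) \<and>
     (\<forall>\<phi>. h (Neg \<phi>) = neg A (h \<phi>)) \<and>
     h Top = tt A \<and>
     h Bot = ff A"

definition valid_in :: "'a matrix \<Rightarrow> rule \<Rightarrow> bool" where
  "valid_in A r \<longleftrightarrow>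
     (\<forall>h. is_valuation A h \<longrightarrow> h ` fst r \<subseteq> designated A \<longrightarrow> h (snd r) \<in> designated A)"

definition Log :: "'a matrix \<Rightarrow> rule set" where
  "Log A = {r. valid_in A r}"

text \<open>Meaningful only if \<open>S\<close> is closed under the operations of \<open>A\<close>.\<close>

definition submatrix :: "'a matrix \<Rightarrow> 'a set \<Rightarrow> 'a matrix" where
  "submatrix A S = A\<lparr>universe := S, designated := designated A \<inter> S\<rparr>"

datatype dm4 = DBot | DN | DB | DTop

instantiation dm4 :: "{distrib_lattice, bounded_lattice}"
begin

definition "bot = DBot"
definition "top = DTop"
definition "x \<le> y \<longleftrightarrow> x = DBot \<or> x = y \<or> y = DTop" for x y :: dm4
definition "x < y \<longleftrightarrow> x \<le> y \<and> x \<noteq> y" for x y :: dm4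
definition "inf x y = (if x \<le> y then x else if y \<le> x then y else DBot)" for x y :: dm4
definition "sup x y = (if x \<le> y then y else if y \<le> x then x else DTop)" for x y :: dm4

instance
proof
  fix x y z :: dm4
  note defs = bot_dm4_def top_dm4_def less_eq_dm4_def less_dm4_def inf_dm4_def sup_dm4_def
  show "x < y \<longleftrightarrow> x \<le> y \<and> \<not> y \<le> x" "x \<le> x" "bot \<le> x" "x \<le> top"
    "inf x y \<le> x" "inf x y \<le> y" "x \<le> sup x y" "y \<le> sup x y"
    by (cases x; cases y; simp add: defs)+
  show "x \<le> y \<Longrightarrow> y \<le> x \<Longrightarrow> x = y"
    by (cases x; cases y; simp add: defs)
  show "x \<le> y \<Longrightarrow> y \<le> z \<Longrightarrow> x \<le> z"
    "x \<le> y \<Longrightarrow> x \<le> z \<Longrightarrow> x \<le> inf y z"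
    "y \<le> x \<Longrightarrow> z \<le> x \<Longrightarrow> sup y z \<le> x"
    "sup x (inf y z) = inf (sup x y) (sup x z)"
    by (cases x; cases y; cases z; simp add: defs)+
qed

end

primrec dm4_neg :: "dm4 \<Rightarrow> dm4" where
  "dm4_neg DBot = DTop"
| "dm4_neg DN = DN"
| "dm4_neg DB = DB"
| "dm4_neg DTop = DBot"

definition DM4_matrix :: "dm4 set \<Rightarrow> dm4 matrix" where
  "DM4_matrix F =
     \<lparr>universe = UNIV, meet = inf, join = sup, neg = dm4_neg, tt = DTop, ff = DBot,
      designated = F\<rparr>"

definition BD4 :: "dm4 matrix" where
  "BD4 = DM4_matrix {DB, DTop}"

definition ETL4 :: "dm4 matrix" where
  "ETL4 = DM4_matrix {DTop}"

definition LP3 :: "dm4 matrix" where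
  "LP3 = submatrix BD4 {DBot, DB, DTop}"

definition B2 :: "dm4 matrix" where
  "B2 = submatrix ETL4 {DBot, DTop}"

definition BD :: "rule set" where
  "BD = Log BD4"

definition ETL :: "rule set" where
  "ETL = Log ETL4"

definition LP :: "rule set" where
  "LP = Log LP3"

definition CL :: "rule set" where
  "CL = Log B2"

definition ECQ :: "rule set" where
  "ECQ = extension_by BD {({Var 0, Neg (Var 0)}, Var 1)}"

end

theory Submission
  imports Defs
begin

text \<open>
  Let a rule of an extension \<open>L\<close> of \<open>BD\<close> fail under some valuation. Substituting constants and
  formulas in one or two variables for the variables, according to their values in the failing
  valuation, turns the rule into a fixed one. Failure in \<open>BD4\<close> gives \<open>p, \<sim>p \<turnstile> q \<or> \<sim>q\<close>, which
  axiomatizes \<open>LP \<inter> ECQ\<close>; failure in \<open>LP3\<close> gives \<open>p, \<sim>p \<turnstile> q\<close>; failure in \<open>LP3\<close> of a rule whose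
  premises are classically satisfiable gives \<open>p, \<sim>p \<or> q \<turnstile> q\<close>, which axiomatizes \<open>ETL\<close>; and
  failure in \<open>B2\<close> makes \<open>L\<close> trivial. That the substituted premises follow in \<open>BD\<close> is seen from
  the monotonicity of all operations in the information order, where \<open>n\<close> is least and \<open>b\<close> is
  greatest. \<open>ECQ\<close> and \<open>LP \<or> ECQ\<close> add to \<open>BD\<close> and \<open>LP\<close> exactly the rules whose premises yield some
  \<open>\<psi>\<close> and \<open>\<sim>\<psi>\<close>, and by compactness a classically unsatisfiable set yields such a pair in \<open>LP\<close>.
\<close>

section \<open>Logics\<close>

lemma is_logicI:
  assumes "\<And>\<Gamma> \<phi>. \<phi> \<in> \<Gamma> \<Longrightarrow> (\<Gamma>, \<phi>) \<in> L"
    and "\<And>\<Gamma> \<Delta> \<phi>. (\<Gamma>, \<phi>) \<in> L \<Longrightarrow> \<Gamma> \<subseteq> \<Delta> \<Longrightarrow> (\<Delta>, \<phi>) \<in> L"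
    and "\<And>\<Gamma> \<Delta> \<phi>. \<forall>\<psi>\<in>\<Delta>. (\<Gamma>, \<psi>) \<in> L \<Longrightarrow> (\<Gamma> \<union> \<Delta>, \<phi>) \<in> L \<Longrightarrow> (\<Gamma>, \<phi>) \<in> L"
    and "\<And>\<Gamma> \<phi> \<sigma>. (\<Gamma>, \<phi>) \<in> L \<Longrightarrow> (subst \<sigma> ` \<Gamma>, subst \<sigma> \<phi>) \<in> L"
  shows "is_logic L"
  unfolding is_logic_def by (intro conjI allI impI; (elim conjE)?; rule assms; assumption)

lemma logic_refl: "is_logic L \<Longrightarrow> \<phi> \<in> \<Gamma> \<Longrightarrow> (\<Gamma>, \<phi>) \<in> L"
  unfolding is_logic_def by (drule conjunct1) simp

lemma logic_mono: "is_logic L \<Longrightarrow> (\<Gamma>, \<phi>) \<in> L \<Longrightarrow> \<Gamma> \<subseteq> \<Delta> \<Longrightarrow> (\<Delta>, \<phi>) \<in> L"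
  unfolding is_logic_def by (drule conjunct2, drule conjunct1) blast

lemma logic_cut_Un:
  "is_logic L \<Longrightarrow> \<forall>\<psi>\<in>\<Delta>. (\<Gamma>, \<psi>) \<in> L \<Longrightarrow> (\<Gamma> \<union> \<Delta>, \<phi>) \<in> L \<Longrightarrow> (\<Gamma>, \<phi>) \<in> L"
  unfolding is_logic_def by (drule conjunct2, drule conjunct2, drule conjunct1) blast

lemma logic_subst: "is_logic L \<Longrightarrow> (\<Gamma>, \<phi>) \<in> L \<Longrightarrow> (subst \<sigma> ` \<Gamma>, subst \<sigma> \<phi>) \<in> L"
  unfolding is_logic_def by (drule conjunct2)+ (erule allE, erule allE, erule allE, erule mp)

lemma logic_cut:
  assumes "is_logic L" "\<And>\<psi>. \<psi> \<in> \<Delta> \<Longrightarrow> (\<Gamma>, \<psi>) \<in> L" "(\<Delta>, \<phi>) \<in> L"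
  shows "(\<Gamma>, \<phi>) \<in> L"
proof (rule logic_cut_Un[OF assms(1)])
  show "(\<Gamma> \<union> \<Delta>, \<phi>) \<in> L"
    by (rule logic_mono[OF assms(1,3)]) simp
qed (use assms(2) in blast)

lemma least_logic_least: "is_logic L \<Longrightarrow> R \<subseteq> L \<Longrightarrow> least_logic R \<subseteq> L"
  unfolding least_logic_def by blast

lemma least_logic_upper: "R \<subseteq> least_logic R"
  unfolding least_logic_def by blast

lemma is_logic_least_logic: "is_logic (least_logic R)"
proof (rule is_logicI)
  have mem: "r \<in> least_logic R \<longleftrightarrow> (\<forall>L. is_logic L \<longrightarrow> R \<subseteq> L \<longrightarrow> r \<in> L)" for r
    by (auto simp: least_logic_def)
  show "(\<Gamma>, \<phi>) \<in> least_logic R"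
    if "\<forall>\<psi>\<in>\<Delta>. (\<Gamma>, \<psi>) \<in> least_logic R" "(\<Gamma> \<union> \<Delta>, \<phi>) \<in> least_logic R" for \<Gamma> \<Delta> \<phi>
    unfolding mem
  proof (intro allI impI)
    fix L assume L: "is_logic L" "R \<subseteq> L"
    with that have "\<forall>\<psi>\<in>\<Delta>. (\<Gamma>, \<psi>) \<in> L" "(\<Gamma> \<union> \<Delta>, \<phi>) \<in> L"
      unfolding mem by blast+
    then show "(\<Gamma>, \<phi>) \<in> L"
      by (rule logic_cut_Un[OF L(1)])
  qed
  show "(\<Gamma>, \<phi>) \<in> least_logic R" if "\<phi> \<in> \<Gamma>" for \<Gamma> \<phi>
    using that logic_refl unfolding mem by blast
  show "(\<Delta>, \<phi>) \<in> least_logic R" if "(\<Gamma>, \<phi>) \<in> least_logic R" "\<Gamma> \<subseteq> \<Delta>" for \<Gamma> \<Delta> \<phi>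
    using that logic_mono unfolding mem by blast
  show "(subst \<sigma> ` \<Gamma>, subst \<sigma> \<phi>) \<in> least_logic R" if "(\<Gamma>, \<phi>) \<in> least_logic R" for \<Gamma> \<phi> \<sigma>
    using that logic_subst unfolding mem by blast
qed

lemma is_logic_Log: "is_logic (Log A)"
proof (rule is_logicI)
  have mem: "(\<Gamma>, \<phi>) \<in> Log A \<longleftrightarrow>
    (\<forall>h. is_valuation A h \<longrightarrow> h ` \<Gamma> \<subseteq> designated A \<longrightarrow> h \<phi> \<in> designated A)" for \<Gamma> \<phi>
    by (simp add: Log_def valid_in_def)
  show "(\<Gamma>, \<phi>) \<in> Log A" if "\<phi> \<in> \<Gamma>" for \<Gamma> \<phi>
    using that unfolding mem by blast
  show "(\<Delta>, \<phi>) \<in> Log A" if "(\<Gamma>, \<phi>) \<in> Log A" "\<Gamma> \<subseteq> \<Delta>" for \<Gamma> \<Delta> \<phi>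
    using that unfolding mem by (meson image_mono subset_trans)
  show "(\<Gamma>, \<phi>) \<in> Log A"
    if "\<forall>\<psi>\<in>\<Delta>. (\<Gamma>, \<psi>) \<in> Log A" "(\<Gamma> \<union> \<Delta>, \<phi>) \<in> Log A" for \<Gamma> \<Delta> \<phi>
    using that unfolding mem by (simp add: image_Un image_subset_iff)
  show "(subst \<sigma> ` \<Gamma>, subst \<sigma> \<phi>) \<in> Log A" if "(\<Gamma>, \<phi>) \<in> Log A" for \<Gamma> \<phi> \<sigma>
    unfolding mem
  proof (intro allI impI)
    fix h assume h: "is_valuation A h" "h ` subst \<sigma> ` \<Gamma> \<subseteq> designated A"
    have "is_valuation A (\<lambda>\<psi>. h (subst \<sigma> \<psi>))"
      using h(1) by (simp add: is_valuation_def)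
    with that have "(\<lambda>\<psi>. h (subst \<sigma> \<psi>)) ` \<Gamma> \<subseteq> designated A \<longrightarrow> h (subst \<sigma> \<phi>) \<in> designated A"
      unfolding mem by (elim allE[of _ "\<lambda>\<psi>. h (subst \<sigma> \<psi>)"]) simp
    with h(2) show "h (subst \<sigma> \<phi>) \<in> designated A"
      by (simp add: image_image)
  qed
qed

section \<open>Closing a logic under explosion\<close>

text \<open>An explicit form of the extension of \<open>L\<close> by explosion: a single use of
  explosion, as the last step, is enough.\<close>

definition explosive_closure :: "rule set \<Rightarrow> rule set" where
  "explosive_closure L =
     {(\<Gamma>, \<phi>). (\<Gamma>, \<phi>) \<in> L \<or> (\<exists>\<psi>. (\<Gamma>, \<psi>) \<in> L \<and> (\<Gamma>, Neg \<psi>) \<in> L)}"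

text \<open>Only cut is delicate. If all cut formulas follow in \<open>L\<close>, cut in
  \<open>L\<close> carries both the conclusion and a contradictory pair over to \<Gamma>. Otherwise
  some cut formula came from explosion, so \<Gamma> itself yields a contradictory pair and hence
  everything.\<close>

lemma is_logic_explosive_closure:
  assumes L: "is_logic L"
  shows "is_logic (explosive_closure L)"
proof (rule is_logicI)
  show "(\<Gamma>, \<phi>) \<in> explosive_closure L"
    if \<Delta>: "\<forall>\<psi>\<in>\<Delta>. (\<Gamma>, \<psi>) \<in> explosive_closure L"
      and \<phi>: "(\<Gamma> \<union> \<Delta>, \<phi>) \<in> explosive_closure L" for \<Gamma> \<Delta> \<phi>
  proof (cases "\<forall>\<psi>\<in>\<Delta>. (\<Gamma>, \<psi>) \<in> L")
    case True
    then have "(\<Gamma>, \<chi>) \<in> L" if "(\<Gamma> \<union> \<Delta>, \<chi>) \<in> L" for \<chi>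
      using that by (rule logic_cut_Un[OF L])
    with \<phi> show ?thesis
      by (auto simp: explosive_closure_def)
  next
    case False
    with \<Delta> show ?thesis
      by (auto simp: explosive_closure_def)
  qed
  show "(subst \<sigma> ` \<Gamma>, subst \<sigma> \<phi>) \<in> explosive_closure L"
    if "(\<Gamma>, \<phi>) \<in> explosive_closure L" for \<Gamma> \<phi> \<sigma>
  proof -
    from that consider "(\<Gamma>, \<phi>) \<in> L" | \<psi> where "(\<Gamma>, \<psi>) \<in> L" "(\<Gamma>, Neg \<psi>) \<in> L"
      unfolding explosive_closure_def by blast
    then show ?thesis
    proof cases
      case 1
      then show ?thesis
        using logic_subst[OF L] by (auto simp: explosive_closure_def)
    next
      case (2 \<psi>)
      then have "(subst \<sigma> ` \<Gamma>, subst \<sigma> \<psi>) \<in> L" "(subst \<sigma> ` \<Gamma>, Neg (subst \<sigma> \<psi>)) \<in> L"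
        using logic_subst[OF L 2(1)] logic_subst[OF L 2(2), of \<sigma>] by simp_all
      then show ?thesis
        unfolding explosive_closure_def by blast
    qed
  qed
  show "(\<Delta>, \<phi>) \<in> explosive_closure L"
    if "(\<Gamma>, \<phi>) \<in> explosive_closure L" "\<Gamma> \<subseteq> \<Delta>" for \<Gamma> \<Delta> \<phi>
    using that logic_mono[OF L, of \<Gamma> _ \<Delta>] unfolding explosive_closure_def by blast
  show "(\<Gamma>, \<phi>) \<in> explosive_closure L" if "\<phi> \<in> \<Gamma>" for \<Gamma> \<phi>
    using that logic_refl[OF L] unfolding explosive_closure_def by blast
qed

lemma explosive_closure_subset:
  assumes L: "is_logic L" and "K \<subseteq> L" and exp: "({Var 0, Neg (Var 0)}, Var 1) \<in> L"
  shows "explosive_closure K \<subseteq> L"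
proof -
  have "(\<Gamma>, \<phi>) \<in> L" if "(\<Gamma>, \<psi>) \<in> L" "(\<Gamma>, Neg \<psi>) \<in> L" for \<Gamma> \<phi> \<psi>
  proof (rule logic_cut[OF L])
    show "({\<psi>, Neg \<psi>}, \<phi>) \<in> L"
      using logic_subst[OF L exp, of "\<lambda>i. if i = 0 then \<psi> else \<phi>"] by simp
  qed (use that in auto)
  with assms(2) show ?thesis
    by (fastforce simp: explosive_closure_def)
qed

lemma explosion_in_explosive_closure:
  "is_logic L \<Longrightarrow> ({\<psi>, Neg \<psi>}, \<phi>) \<in> explosive_closure L"
  using logic_refl[of L _ "{\<psi>, Neg \<psi>}"] by (auto simp: explosive_closure_def)

section \<open>Four-valued semantics\<close>

primrec eval :: "(nat \<Rightarrow> dm4) \<Rightarrow> fm \<Rightarrow> dm4" where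
  "eval e (Var i) = e i"
| "eval e (Conj \<phi> \<psi>) = inf (eval e \<phi>) (eval e \<psi>)"
| "eval e (Disj \<phi> \<psi>) = sup (eval e \<phi>) (eval e \<psi>)"
| "eval e (Neg \<phi>) = dm4_neg (eval e \<phi>)"
| "eval e Top = DTop"
| "eval e Bot = DBot"

lemma eval_subst: "eval e (subst \<sigma> \<phi>) = eval (\<lambda>i. eval e (\<sigma> i)) \<phi>"
  by (induction \<phi>) auto

lemmas dm4_simps = less_eq_dm4_def inf_dm4_def sup_dm4_def

definition subuniverse :: "dm4 set \<Rightarrow> bool" where
  "subuniverse S \<longleftrightarrow> DTop \<in> S \<and> DBot \<in> S \<and>
     (\<forall>x\<in>S. dm4_neg x \<in> S \<and> (\<forall>y\<in>S. inf x y \<in> S \<and> sup x y \<in> S))"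

lemma eval_in_subuniverse:
  assumes "subuniverse S" "range e \<subseteq> S"
  shows "eval e \<phi> \<in> S"
  using assms by (induction \<phi>) (auto simp: subuniverse_def)

text \<open>Valuations correspond to assignments of the variables into \<open>S\<close>. Testing
  against \<open>F\<close> instead of \<open>F \<inter> S\<close> is the same, since
  \<open>eval\<close> never leaves a subuniverse.\<close>

lemma mem_Log_iff:
  assumes S: "subuniverse S"
  shows "(\<Gamma>, \<phi>) \<in> Log (submatrix (DM4_matrix F) S) \<longleftrightarrow>
    (\<forall>e. range e \<subseteq> S \<longrightarrow> eval e ` \<Gamma> \<subseteq> F \<longrightarrow> eval e \<phi> \<in> F)"
proof -
  let ?A = "submatrix (DM4_matrix F) S"
  have val: "is_valuation ?A (eval e)" if "range e \<subseteq> S" for e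
    using eval_in_subuniverse[OF S that]
    by (simp add: is_valuation_def submatrix_def DM4_matrix_def)
  have val': "range (h \<circ> Var) \<subseteq> S \<and> eval (h \<circ> Var) = h" if h: "is_valuation ?A h" for h
  proof -
    have "eval (h \<circ> Var) \<psi> = h \<psi>" for \<psi>
      using h by (induction \<psi>) (auto simp: is_valuation_def submatrix_def DM4_matrix_def)
    moreover have "range (h \<circ> Var) \<subseteq> S"
      using h by (auto simp: is_valuation_def submatrix_def DM4_matrix_def)
    ultimately show ?thesis
      by auto
  qed
  have des: "designated ?A = F \<inter> S"
    by (simp add: submatrix_def DM4_matrix_def)
  show ?thesis
  proof
    assume *: "(\<Gamma>, \<phi>) \<in> Log ?A"
    show "\<forall>e. range e \<subseteq> S \<longrightarrow> eval e ` \<Gamma> \<subseteq> F \<longrightarrow> eval e \<phi> \<in> F"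
    proof (intro allI impI)
      fix e assume e: "range e \<subseteq> S" "eval e ` \<Gamma> \<subseteq> F"
      then have "eval e ` \<Gamma> \<subseteq> F \<inter> S"
        using eval_in_subuniverse[OF S e(1)] by blast
      with * val[OF e(1)] show "eval e \<phi> \<in> F"
        by (auto simp: Log_def valid_in_def des)
    qed
  next
    assume *: "\<forall>e. range e \<subseteq> S \<longrightarrow> eval e ` \<Gamma> \<subseteq> F \<longrightarrow> eval e \<phi> \<in> F"
    show "(\<Gamma>, \<phi>) \<in> Log ?A"
      unfolding Log_def valid_in_def mem_Collect_eq des fst_conv snd_conv
    proof (intro allI impI)
      fix h assume h: "is_valuation ?A h" "h ` \<Gamma> \<subseteq> F \<inter> S"
      have "eval (h \<circ> Var) ` \<Gamma> \<subseteq> F \<longrightarrow> eval (h \<circ> Var) \<phi> \<in> F"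
        using * val'[OF h(1)] by blast
      then have "h ` \<Gamma> \<subseteq> F \<longrightarrow> h \<phi> \<in> F"
        using val'[OF h(1)] by simp
      moreover have "h \<phi> \<in> S"
        using h(1) by (simp add: is_valuation_def submatrix_def DM4_matrix_def)
      ultimately show "h \<phi> \<in> F \<inter> S"
        using h(2) by blast
    qed
  qed
qed

section \<open>Membership in the four logics\<close>

lemma subuniverse_UNIV: "subuniverse UNIV"
  by (simp add: subuniverse_def)

lemma subuniverse_LP: "subuniverse {DBot, DB, DTop}"
  by (simp add: subuniverse_def dm4_simps)

lemma subuniverse_CL: "subuniverse {DBot, DTop}"
  by (simp add: subuniverse_def dm4_simps)

lemma submatrix_UNIV: "submatrix (DM4_matrix F) UNIV = DM4_matrix F"
  by (simp add: submatrix_def DM4_matrix_def)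

lemma mem_BD:
  "(\<Gamma>, \<phi>) \<in> BD \<longleftrightarrow> (\<forall>e. eval e ` \<Gamma> \<subseteq> {DB, DTop} \<longrightarrow> eval e \<phi> \<in> {DB, DTop})"
  using mem_Log_iff[OF subuniverse_UNIV] by (simp add: BD_def BD4_def submatrix_UNIV)

lemma mem_ETL: "(\<Gamma>, \<phi>) \<in> ETL \<longleftrightarrow> (\<forall>e. eval e ` \<Gamma> \<subseteq> {DTop} \<longrightarrow> eval e \<phi> = DTop)"
  using mem_Log_iff[OF subuniverse_UNIV] by (simp add: ETL_def ETL4_def submatrix_UNIV)

lemma mem_LP:
  "(\<Gamma>, \<phi>) \<in> LP \<longleftrightarrow>
    (\<forall>e. range e \<subseteq> {DBot, DB, DTop} \<longrightarrow> eval e ` \<Gamma> \<subseteq> {DB, DTop} \<longrightarrow> eval e \<phi> \<in> {DB, DTop})"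
  unfolding LP_def LP3_def BD4_def by (rule mem_Log_iff[OF subuniverse_LP])

lemma mem_CL:
  "(\<Gamma>, \<phi>) \<in> CL \<longleftrightarrow>
    (\<forall>e. range e \<subseteq> {DBot, DTop} \<longrightarrow> eval e ` \<Gamma> \<subseteq> {DTop} \<longrightarrow> eval e \<phi> = DTop)"
  using mem_Log_iff[OF subuniverse_CL] by (simp add: CL_def B2_def ETL4_def)

lemma is_logic_BD: "is_logic BD" and is_logic_LP: "is_logic LP"
  by (simp_all add: BD_def LP_def is_logic_Log)

lemma BD_subset_LP: "BD \<subseteq> LP"
  by (auto simp: mem_BD mem_LP)

section \<open>The information order\<close>

definition info_le :: "dm4 \<Rightarrow> dm4 \<Rightarrow> bool" where
  "info_le x y \<longleftrightarrow> x = DN \<or> x = y \<or> y = DB"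

lemma info_le_inf: "info_le a b \<Longrightarrow> info_le c d \<Longrightarrow> info_le (inf a c) (inf b d)"
  by (cases a; cases b; cases c; cases d; simp add: info_le_def dm4_simps)

lemma info_le_sup: "info_le a b \<Longrightarrow> info_le c d \<Longrightarrow> info_le (sup a c) (sup b d)"
  by (cases a; cases b; cases c; cases d; simp add: info_le_def dm4_simps)

lemma info_le_neg: "info_le a b \<Longrightarrow> info_le (dm4_neg a) (dm4_neg b)"
  by (cases a; cases b; simp add: info_le_def)

lemma info_le_eval: "(\<And>i. info_le (e i) (f i)) \<Longrightarrow> info_le (eval e \<phi>) (eval f \<phi>)"
  by (induction \<phi>) (simp_all add: info_le_inf info_le_sup info_le_neg, simp_all add: info_le_def)

text \<open>The designated set of \<open>BD4\<close> is an upset in the information order as well,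
  so raising an assignment preserves designated premises.\<close>

lemma info_le_designated: "info_le x y \<Longrightarrow> x \<in> {DB, DTop} \<Longrightarrow> y \<in> {DB, DTop}"
  by (auto simp: info_le_def)

section \<open>Compactness\<close>

text \<open>Compactness of a countable power of a finite discrete space, for sets decided by
  finitely many coordinates. A point is built coordinate by coordinate, keeping \<open>good\<close>:
  every finite subfamily has a common member extending the prefix chosen so far.\<close>

lemma compactness:
  fixes K :: "(nat \<Rightarrow> 'a :: finite) set set"
  assumes local: "\<And>C. C \<in> K \<Longrightarrow> \<exists>n. \<forall>e f. (\<forall>i<n. e i = f i) \<longrightarrow> e \<in> C \<longrightarrow> f \<in> C"
    and fip: "\<And>K0. finite K0 \<Longrightarrow> K0 \<subseteq> K \<Longrightarrow> \<Inter>K0 \<noteq> {}"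
  shows "\<Inter>K \<noteq> {}"
proof -
  define ext where "ext n s K0 \<longleftrightarrow> (\<exists>e. e \<in> \<Inter>K0 \<and> (\<forall>i<n. e i = s i))"
    for n :: nat and s :: "nat \<Rightarrow> 'a" and K0
  define good where "good n s \<longleftrightarrow> (\<forall>K0. finite K0 \<longrightarrow> K0 \<subseteq> K \<longrightarrow> ext n s K0)" for n s
  have step: "\<exists>a. good (Suc n) (s(n := a))" if good: "good n s" for n s
  proof (rule ccontr)
    assume "\<not> ?thesis"
    then have "\<forall>a. \<exists>K0. finite K0 \<and> K0 \<subseteq> K \<and> \<not> ext (Suc n) (s(n := a)) K0"
      unfolding good_def by blast
    then obtain B where B: "\<And>a. finite (B a)" "\<And>a. B a \<subseteq> K"
      "\<And>a. \<not> ext (Suc n) (s(n := a)) (B a)"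
      by metis
    \<comment> \<open>Finiteness of \<open>'a\<close> makes the union of the bad subfamilies finite.
      A common member \<open>e\<close> extending the prefix then contradicts the choice of
      \<open>B (e n)\<close>.\<close>
    have "finite (\<Union>a. B a)" "(\<Union>a. B a) \<subseteq> K"
      using B(1,2) by auto
    then have "ext n s (\<Union>a. B a)"
      using good unfolding good_def by blast
    then obtain e where e: "e \<in> \<Inter>(\<Union>a. B a)" "\<forall>i<n. e i = s i"
      unfolding ext_def by blast
    then have "e \<in> \<Inter>(B (e n))" "\<forall>i<Suc n. e i = (s(n := e n)) i"
      by auto
    then have "ext (Suc n) (s(n := e n)) (B (e n))"
      unfolding ext_def by blast
    with B(3) show False
      by blast
  qed
  have "good 0 s" for s
    unfolding good_def ext_def using fip by (metis ex_in_conv not_less_zero)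
  then have "\<exists>S. \<forall>n. good n (S n) \<and> (\<exists>a. S (Suc n) = (S n)(n := a))"
    by (intro dependent_nat_choice) (use step in blast)+
  then obtain S where S: "\<And>n. good n (S n)" "\<And>n. \<exists>a. S (Suc n) = (S n)(n := a)"
    by blast
  \<comment> \<open>Coordinate \<open>i\<close> is set in passing to stage \<open>Suc i\<close> and
    never changed afterwards.\<close>
  define f where "f i = S (Suc i) i" for i
  have agree: "\<forall>i<n. S n i = f i" for n
  proof (induction n)
    case (Suc n)
    with S(2)[of n] show ?case
      by (auto simp: f_def less_Suc_eq)
  qed simp
  have "f \<in> C" if C: "C \<in> K" for C
  proof -
    obtain n where n: "\<And>e g. \<forall>i<n. e i = g i \<Longrightarrow> e \<in> C \<Longrightarrow> g \<in> C"
      using local[OF C] by blast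
    have "ext n (S n) {C}"
      using S(1)[of n] C unfolding good_def by simp
    then obtain e where "e \<in> C" "\<forall>i<n. e i = S n i"
      unfolding ext_def by auto
    with n[of e f] agree[of n] show ?thesis
      by simp
  qed
  then show ?thesis
    by blast
qed

lemma eval_local: "\<exists>n. \<forall>e f. (\<forall>i<n. e i = f i) \<longrightarrow> eval e \<phi> = eval f \<phi>"
proof (induction \<phi>)
  case (Var i)
  show ?case
    by (rule exI[of _ "Suc i"]) simp
next
  case (Conj \<phi> \<psi>)
  then obtain m n where "\<forall>e f. (\<forall>i<m. e i = f i) \<longrightarrow> eval e \<phi> = eval f \<phi>"
    "\<forall>e f. (\<forall>i<n. e i = f i) \<longrightarrow> eval e \<psi> = eval f \<psi>"
    by blast
  then show ?case
    by (intro exI[of _ "max m n"]) (metis eval.simps(2) less_max_iff_disj)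
next
  case (Disj \<phi> \<psi>)
  then obtain m n where "\<forall>e f. (\<forall>i<m. e i = f i) \<longrightarrow> eval e \<phi> = eval f \<phi>"
    "\<forall>e f. (\<forall>i<n. e i = f i) \<longrightarrow> eval e \<psi> = eval f \<psi>"
    by blast
  then show ?case
    by (intro exI[of _ "max m n"]) (metis eval.simps(3) less_max_iff_disj)
next
  case (Neg \<phi>)
  then show ?case
    by (metis eval.simps(4))
qed simp_all

instance dm4 :: finite
proof
  have "UNIV = {DBot, DN, DB, DTop}"
    using dm4.exhaust by blast
  then show "finite (UNIV :: dm4 set)"
    by (metis finite.emptyI finite.insertI)
qed

text \<open>A pair \<open>c\<close> is a constraint: the value of \<open>fst c\<close> must lie in
  \<open>snd c\<close>. This form covers true premises, a refuted conclusion and a restricted range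
  for the variables.\<close>

lemma eval_compactness:
  assumes "\<And>C0. finite C0 \<Longrightarrow> C0 \<subseteq> C \<Longrightarrow> \<exists>e. \<forall>c\<in>C0. eval e (fst c) \<in> snd c"
  shows "\<exists>e. \<forall>c\<in>C. eval e (fst c) \<in> snd c"
proof -
  let ?sat = "\<lambda>c. {e. eval e (fst c) \<in> snd c}"
  have "\<Inter>(?sat ` C) \<noteq> {}"
  proof (rule compactness)
    fix D assume "D \<in> ?sat ` C"
    then obtain c where "D = ?sat c"
      by blast
    then show "\<exists>n. \<forall>e f. (\<forall>i<n. e i = f i) \<longrightarrow> e \<in> D \<longrightarrow> f \<in> D"
      using eval_local[of "fst c"] by (metis mem_Collect_eq)
  next
    fix K0 assume "finite K0" "K0 \<subseteq> ?sat ` C"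
    then obtain C0 where C0: "C0 \<subseteq> C" "finite C0" "K0 = ?sat ` C0"
      by (meson finite_subset_image)
    then obtain e where "\<forall>c\<in>C0. eval e (fst c) \<in> snd c"
      using assms by blast
    then have "e \<in> \<Inter>K0"
      using C0(3) by simp
    then show "\<Inter>K0 \<noteq> {}"
      by blast
  qed
  then show ?thesis
    by blast
qed

text \<open>One formula serves both notions of truth, because {b, top} and {top} are both lattice
  filters.\<close>

lemma finite_conjunction:
  assumes "finite \<Gamma>"
  obtains \<gamma> where "\<And>e. eval e \<gamma> \<in> {DB, DTop} \<longleftrightarrow> eval e ` \<Gamma> \<subseteq> {DB, DTop}"
    and "\<And>e. eval e \<gamma> = DTop \<longleftrightarrow> eval e ` \<Gamma> \<subseteq> {DTop}"
  using assms
proof (induction arbitrary: thesis)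
  case empty
  show ?case
    by (rule empty.prems[of Top]) simp_all
next
  case (insert \<phi> \<Gamma>)
  obtain \<gamma> where \<gamma>: "\<And>e. eval e \<gamma> \<in> {DB, DTop} \<longleftrightarrow> eval e ` \<Gamma> \<subseteq> {DB, DTop}"
    "\<And>e. eval e \<gamma> = DTop \<longleftrightarrow> eval e ` \<Gamma> \<subseteq> {DTop}"
    using insert.IH by metis
  have inf: "inf x y \<in> {DB, DTop} \<longleftrightarrow> x \<in> {DB, DTop} \<and> y \<in> {DB, DTop}"
    "inf x y = DTop \<longleftrightarrow> x = DTop \<and> y = DTop" for x y
    by (cases x; cases y; simp add: dm4_simps)+
  show ?case
    by (rule insert.prems[of "Conj \<phi> \<gamma>"])
      (simp_all only: eval.simps inf \<gamma> image_insert insert_subset singleton_iff)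
qed

section \<open>Consequences of compactness\<close>

lemma ETL_finitary:
  assumes "(\<Gamma>, \<phi>) \<in> ETL"
  shows "\<exists>\<Gamma>0. finite \<Gamma>0 \<and> \<Gamma>0 \<subseteq> \<Gamma> \<and> (\<Gamma>0, \<phi>) \<in> ETL"
proof (rule ccontr)
  assume none: "\<not> ?thesis"
  let ?C = "insert (\<phi>, - {DTop}) (\<Gamma> \<times> {{DTop}})"
  have "\<exists>e. \<forall>c\<in>?C. eval e (fst c) \<in> snd c"
  proof (rule eval_compactness)
    fix C0 assume C0: "finite C0" "C0 \<subseteq> ?C"
    let ?\<Gamma>0 = "fst ` C0 \<inter> \<Gamma>"
    have "finite ?\<Gamma>0" "?\<Gamma>0 \<subseteq> \<Gamma>"
      using C0(1) by simp_all
    with none have "(?\<Gamma>0, \<phi>) \<notin> ETL"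
      by blast
    then obtain e where e: "eval e ` ?\<Gamma>0 \<subseteq> {DTop}" "eval e \<phi> \<noteq> DTop"
      unfolding mem_ETL by blast
    have "eval e (fst c) \<in> snd c" if c: "c \<in> C0" for c
    proof -
      consider "c = (\<phi>, - {DTop})" | "fst c \<in> ?\<Gamma>0" "snd c = {DTop}"
        using c C0(2) by fastforce
      then show ?thesis
        by cases (use e in auto)
    qed
    then show "\<exists>e. \<forall>c\<in>C0. eval e (fst c) \<in> snd c"
      by blast
  qed
  then obtain e where "\<forall>c\<in>?C. eval e (fst c) \<in> snd c"
    by (rule exE)
  then have "eval e \<phi> \<noteq> DTop" "eval e ` \<Gamma> \<subseteq> {DTop}"
    by (simp_all add: image_subset_iff)
  with assms show False
    unfolding mem_ETL by blast
qed

definition classically_satisfiable :: "fm set \<Rightarrow> bool" where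
  "classically_satisfiable \<Gamma> \<longleftrightarrow> (\<exists>e. range e \<subseteq> {DBot, DTop} \<and> eval e ` \<Gamma> \<subseteq> {DTop})"

lemma classical_compactness:
  assumes "\<And>\<Gamma>0. finite \<Gamma>0 \<Longrightarrow> \<Gamma>0 \<subseteq> \<Gamma> \<Longrightarrow> classically_satisfiable \<Gamma>0"
  shows "classically_satisfiable \<Gamma>"
proof -
  \<comment> \<open>Classicality of the assignment is itself expressed by constraints, one for each
    variable.\<close>
  let ?C = "range Var \<times> {{DBot, DTop}} \<union> \<Gamma> \<times> {{DTop}}"
  have "\<exists>e. \<forall>c\<in>?C. eval e (fst c) \<in> snd c"
  proof (rule eval_compactness)
    fix C0 assume C0: "finite C0" "C0 \<subseteq> ?C"
    let ?\<Gamma>0 = "fst ` C0 \<inter> \<Gamma>"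
    have "finite ?\<Gamma>0" "?\<Gamma>0 \<subseteq> \<Gamma>"
      using C0(1) by simp_all
    from assms[OF this] obtain e where e: "range e \<subseteq> {DBot, DTop}" "eval e ` ?\<Gamma>0 \<subseteq> {DTop}"
      unfolding classically_satisfiable_def by (elim exE conjE)
    have "eval e (fst c) \<in> snd c" if c: "c \<in> C0" for c
    proof -
      have "fst c \<in> range Var \<and> snd c = {DBot, DTop} \<or> fst c \<in> ?\<Gamma>0 \<and> snd c = {DTop}"
        using subsetD[OF C0(2) c] c by (simp add: mem_Times_iff)
      then show ?thesis
      proof (elim disjE conjE)
        assume "fst c \<in> range Var" "snd c = {DBot, DTop}"
        then obtain i where "fst c = Var i"
          by blast
        moreover have "e i \<in> {DBot, DTop}"
          using e(1) by blast
        ultimately show ?thesis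
          using \<open>snd c = _\<close> by simp
      next
        assume "fst c \<in> ?\<Gamma>0" "snd c = {DTop}"
        with e(2) show ?thesis
          by blast
      qed
    qed
    then show "\<exists>e. \<forall>c\<in>C0. eval e (fst c) \<in> snd c"
      by blast
  qed
  then obtain e where "\<forall>c\<in>?C. eval e (fst c) \<in> snd c"
    by (rule exE)
  then have "\<forall>i. e i \<in> {DBot, DTop}" "\<forall>\<gamma>\<in>\<Gamma>. eval e \<gamma> = DTop"
    by (simp_all add: ball_Un)
  then have "range e \<subseteq> {DBot, DTop} \<and> eval e ` \<Gamma> \<subseteq> {DTop}"
    by blast
  then show ?thesis
    unfolding classically_satisfiable_def by blast
qed

text \<open>The conjunction \<gamma> of a finite unsatisfiable part takes the value b at every
  three-valued model of \<Gamma>, so it can serve as \<psi>.\<close>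

lemma LP_contradiction_of_unsat:
  assumes "\<not> classically_satisfiable \<Gamma>"
  shows "\<exists>\<psi>. (\<Gamma>, \<psi>) \<in> LP \<and> (\<Gamma>, Neg \<psi>) \<in> LP"
proof -
  obtain \<Gamma>0 where \<Gamma>0: "finite \<Gamma>0" "\<Gamma>0 \<subseteq> \<Gamma>"
    and unsat: "\<not> classically_satisfiable \<Gamma>0"
    using assms classical_compactness by blast
  obtain \<gamma> where \<gamma>: "\<And>e. eval e \<gamma> \<in> {DB, DTop} \<longleftrightarrow> eval e ` \<Gamma>0 \<subseteq> {DB, DTop}"
    "\<And>e. eval e \<gamma> = DTop \<longleftrightarrow> eval e ` \<Gamma>0 \<subseteq> {DTop}"
    using finite_conjunction[OF \<Gamma>0(1)] by metis
  have "eval e \<gamma> = DB" if e: "range e \<subseteq> {DBot, DB, DTop}" "eval e ` \<Gamma> \<subseteq> {DB, DTop}" for e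
  proof -
    \<comment> \<open>Replacing b by top gives a classical assignment below \<open>e\<close> in
      information. There \<gamma> is bot by unsatisfiability, and the only designated value above
      bot in information is b.\<close>
    define f where "f i = (if e i = DB then DTop else e i)" for i
    have f: "range f \<subseteq> {DBot, DTop}"
      using e(1) by (auto simp: f_def)
    have "info_le (eval f \<gamma>) (eval e \<gamma>)"
      by (rule info_le_eval) (auto simp: f_def info_le_def)
    moreover have "eval f \<gamma> \<noteq> DTop"
      using unsat f \<gamma>(2)[of f] unfolding classically_satisfiable_def by blast
    moreover have "eval f \<gamma> \<in> {DBot, DTop}"
      by (rule eval_in_subuniverse[OF subuniverse_CL f])
    moreover have "eval e \<gamma> \<in> {DB, DTop}"
      unfolding \<gamma>(1) using e(2) \<Gamma>0(2) by blast
    ultimately show ?thesis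
      by (auto simp: info_le_def)
  qed
  then have "(\<Gamma>, \<gamma>) \<in> LP \<and> (\<Gamma>, Neg \<gamma>) \<in> LP"
    by (simp add: mem_LP)
  then show ?thesis
    by blast
qed

section \<open>Extensions of \<open>BD\<close>\<close>

lemma ECQ_eq: "ECQ = explosive_closure BD"
proof
  show "ECQ \<subseteq> explosive_closure BD"
    unfolding ECQ_def extension_by_def
    using explosion_in_explosive_closure[OF is_logic_BD]
    by (intro least_logic_least is_logic_explosive_closure is_logic_BD)
      (auto simp: explosive_closure_def)
  show "explosive_closure BD \<subseteq> ECQ"
    unfolding ECQ_def extension_by_def
    by (intro explosive_closure_subset is_logic_least_logic)
      (use least_logic_upper in blast)+
qed

lemma join_LP_ECQ_eq: "logic_join LP ECQ = explosive_closure LP"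
proof
  have "ECQ \<subseteq> explosive_closure LP"
    unfolding ECQ_eq using BD_subset_LP by (auto simp: explosive_closure_def)
  then show "logic_join LP ECQ \<subseteq> explosive_closure LP"
    unfolding logic_join_def
    by (intro least_logic_least is_logic_explosive_closure is_logic_LP)
      (auto simp: explosive_closure_def)
  have "({Var 0, Neg (Var 0)}, Var 1) \<in> ECQ"
    unfolding ECQ_eq by (rule explosion_in_explosive_closure[OF is_logic_BD])
  then show "explosive_closure LP \<subseteq> logic_join LP ECQ"
    unfolding logic_join_def
    by (intro explosive_closure_subset is_logic_least_logic)
      (use least_logic_upper in blast)+
qed

section \<open>Fixed rules extracted from an arbitrary rule\<close>

text \<open>The common scheme of the extractions: one substitution instance of the rule is used in
  \<open>L\<close>, while \<open>BD\<close> supplies its premises from \<Delta> and \<chi> from its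
  conclusion. A substituted formula at \<open>e\<close> is the original one at
  \<open>\<lambda>i. eval e (\<sigma> i)\<close>.\<close>

lemma derive_by_substitution:
  assumes L: "is_logic L" "BD \<subseteq> L" and rule: "(\<Gamma>, \<phi>) \<in> L"
    and prem: "\<And>e \<gamma>. eval e ` \<Delta> \<subseteq> {DB, DTop} \<Longrightarrow> \<gamma> \<in> \<Gamma> \<Longrightarrow>
      eval (\<lambda>i. eval e (\<sigma> i)) \<gamma> \<in> {DB, DTop}"
    and concl: "\<And>e. eval e ` \<Delta> \<subseteq> {DB, DTop} \<Longrightarrow> eval (\<lambda>i. eval e (\<sigma> i)) \<phi> \<in> {DB, DTop} \<Longrightarrow>
      eval e \<chi> \<in> {DB, DTop}"
  shows "(\<Delta>, \<chi>) \<in> L"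
proof (rule logic_cut[OF L(1)])
  have "(\<Delta>, subst \<sigma> \<gamma>) \<in> L" if "\<gamma> \<in> \<Gamma>" for \<gamma>
    using prem that L(2) by (auto simp: mem_BD eval_subst subset_iff)
  then have "(\<Delta>, subst \<sigma> \<phi>) \<in> L"
    using logic_cut[OF L(1) _ logic_subst[OF L(1) rule, of \<sigma>]] by blast
  then show "(\<Delta>, \<psi>) \<in> L" if "\<psi> \<in> insert (subst \<sigma> \<phi>) \<Delta>" for \<psi>
    using that logic_refl[OF L(1)] by blast
  have "(insert (subst \<sigma> \<phi>) \<Delta>, \<chi>) \<in> BD"
    using concl unfolding mem_BD by (simp add: eval_subst)
  with L(2) show "(insert (subst \<sigma> \<phi>) \<Delta>, \<chi>) \<in> L"
    by blast
qed

lemma LP_ECQ_rule_in_proper_extension: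
  assumes L: "is_logic L" "BD \<subseteq> L" "L \<noteq> BD"
  shows "({Var 0, Neg (Var 0)}, Disj (Var 1) (Neg (Var 1))) \<in> L"
proof -
  obtain \<Gamma> \<phi> where rule: "(\<Gamma>, \<phi>) \<in> L" "(\<Gamma>, \<phi>) \<notin> BD"
    using L(2,3) by auto
  then obtain v where v: "eval v ` \<Gamma> \<subseteq> {DB, DTop}" "eval v \<phi> \<notin> {DB, DTop}"
    unfolding mem_BD by blast
  \<comment> \<open>The premises force \<open>p\<close> to be b, so the substituted assignment
    differs from \<open>v\<close> only where \<open>v\<close> is n. There it takes the value of
    \<open>q\<close>, which is above n in information.\<close>
  define \<sigma> where
    "\<sigma> i = (case v i of DBot \<Rightarrow> Bot | DN \<Rightarrow> Var 1 | DB \<Rightarrow> Var 0 | DTop \<Rightarrow> Top)" for i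
  have p: "e 0 = DB" if "eval e ` {Var 0, Neg (Var 0)} \<subseteq> {DB, DTop}" for e
    using that by (cases "e 0") auto
  show ?thesis
  proof (rule derive_by_substitution[OF L(1,2) rule(1), where \<sigma> = \<sigma>])
    fix e \<gamma> assume e: "eval e ` {Var 0, Neg (Var 0)} \<subseteq> {DB, DTop}" and "\<gamma> \<in> \<Gamma>"
    have "info_le (v i) (eval e (\<sigma> i))" for i
      using p[OF e] by (cases "v i") (auto simp: \<sigma>_def info_le_def)
    then have "info_le (eval v \<gamma>) (eval (\<lambda>i. eval e (\<sigma> i)) \<gamma>)"
      by (rule info_le_eval)
    with v(1) \<open>\<gamma> \<in> \<Gamma>\<close> show "eval (\<lambda>i. eval e (\<sigma> i)) \<gamma> \<in> {DB, DTop}"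
      by (metis image_subset_iff info_le_designated)
  next
    fix e assume e: "eval e ` {Var 0, Neg (Var 0)} \<subseteq> {DB, DTop}"
      and \<phi>: "eval (\<lambda>i. eval e (\<sigma> i)) \<phi> \<in> {DB, DTop}"
    \<comment> \<open>With \<open>q\<close> = n the refuting assignment \<open>v\<close> is
      recovered exactly, so a designated conclusion excludes n; excluded middle for \<open>q\<close>
      fails only at n.\<close>
    have "e 1 \<noteq> DN"
    proof
      assume "e 1 = DN"
      then have "(\<lambda>i. eval e (\<sigma> i)) = v"
        using p[OF e] by (auto simp: \<sigma>_def split: dm4.split)
      with \<phi> v(2) show False
        by simp
    qed
    then show "eval e (Disj (Var 1) (Neg (Var 1))) \<in> {DB, DTop}"
      by (cases "e 1") (auto simp: dm4_simps)
  qed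
qed

text \<open>Contradictory premises yield excluded middle for every variable by the given rule. Under
  these extra premises, consequence in \<open>BD\<close> already includes consequence in
  \<open>LP\<close>.\<close>

lemma LP_Int_ECQ_subset:
  assumes L: "is_logic L" "BD \<subseteq> L"
    and rule: "({Var 0, Neg (Var 0)}, Disj (Var 1) (Neg (Var 1))) \<in> L"
  shows "LP \<inter> ECQ \<subseteq> L"
proof clarify
  fix \<Gamma> \<phi> assume LP: "(\<Gamma>, \<phi>) \<in> LP" and "(\<Gamma>, \<phi>) \<in> ECQ"
  then consider "(\<Gamma>, \<phi>) \<in> BD" | \<psi> where "(\<Gamma>, \<psi>) \<in> BD" "(\<Gamma>, Neg \<psi>) \<in> BD"
    unfolding ECQ_eq explosive_closure_def by blast
  then show "(\<Gamma>, \<phi>) \<in> L"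
  proof cases
    case 1
    with L(2) show ?thesis by blast
  next
    case (2 \<psi>)
    have em: "(\<Gamma>, Disj (Var i) (Neg (Var i))) \<in> L" for i
    proof (rule logic_cut[OF L(1)])
      show "({\<psi>, Neg \<psi>}, Disj (Var i) (Neg (Var i))) \<in> L"
        using logic_subst[OF L(1) rule, of "\<lambda>j. if j = 0 then \<psi> else Var i"] by simp
    qed (use 2 L(2) in auto)
    let ?EM = "range (\<lambda>i. Disj (Var i) (Neg (Var i)))"
    show ?thesis
    proof (rule logic_cut[OF L(1)])
      show "(\<Gamma>, \<chi>) \<in> L" if "\<chi> \<in> \<Gamma> \<union> ?EM" for \<chi>
        using that em logic_refl[OF L(1)] by blast
      \<comment> \<open>Designating all of \<open>?EM\<close> keeps every variable away from n, so
        \<open>e\<close> is an assignment into \<open>LP3\<close>.\<close>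
      have "(\<Gamma> \<union> ?EM, \<phi>) \<in> BD"
        unfolding mem_BD
      proof (intro allI impI)
        fix e assume e: "eval e ` (\<Gamma> \<union> ?EM) \<subseteq> {DB, DTop}"
        have "e i \<in> {DBot, DB, DTop}" for i
        proof -
          have "eval e (Disj (Var i) (Neg (Var i))) \<in> {DB, DTop}"
            using e by blast
          then show ?thesis
            by (cases "e i") (auto simp: dm4_simps)
        qed
        then show "eval e \<phi> \<in> {DB, DTop}"
          using LP e unfolding mem_LP by blast
      qed
      with L(2) show "(\<Gamma> \<union> ?EM, \<phi>) \<in> L"
        by blast
    qed
  qed
qed

lemma ECQ_subset_if_not_subset_LP:
  assumes L: "is_logic L" "BD \<subseteq> L" "\<not> L \<subseteq> LP"
  shows "ECQ \<subseteq> L"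
proof -
  obtain \<Gamma> \<phi> where rule: "(\<Gamma>, \<phi>) \<in> L" "(\<Gamma>, \<phi>) \<notin> LP"
    using L(3) by auto
  then obtain v where v: "range v \<subseteq> {DBot, DB, DTop}" "eval v ` \<Gamma> \<subseteq> {DB, DTop}"
    "eval v \<phi> \<notin> {DB, DTop}"
    unfolding mem_LP by blast
  \<comment> \<open>Since \<open>v\<close> omits n, the last case means b. The premises force
    \<open>p\<close> = b, which reproduces \<open>v\<close>, so the substituted conclusion is never
    designated and anything follows from it.\<close>
  define \<sigma> where "\<sigma> i = (case v i of DBot \<Rightarrow> Bot | DTop \<Rightarrow> Top | _ \<Rightarrow> Var 0)" for i
  have \<sigma>: "(\<lambda>i. eval e (\<sigma> i)) = v" if "eval e ` {Var 0, Neg (Var 0)} \<subseteq> {DB, DTop}" for e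
  proof
    fix i
    have "e 0 = DB"
      using that by (cases "e 0") auto
    moreover have "v i \<in> {DBot, DB, DTop}"
      using v(1) by blast
    ultimately show "eval e (\<sigma> i) = v i"
      by (auto simp: \<sigma>_def)
  qed
  have "({Var 0, Neg (Var 0)}, Var 1) \<in> L"
  proof (rule derive_by_substitution[OF L(1,2) rule(1), where \<sigma> = \<sigma>])
    fix e \<gamma> assume "eval e ` {Var 0, Neg (Var 0)} \<subseteq> {DB, DTop}" "\<gamma> \<in> \<Gamma>"
    with v(2) show "eval (\<lambda>i. eval e (\<sigma> i)) \<gamma> \<in> {DB, DTop}"
      unfolding \<sigma>[OF \<open>eval e ` _ \<subseteq> _\<close>] by blast
  next
    fix e assume e: "eval e ` {Var 0, Neg (Var 0)} \<subseteq> {DB, DTop}"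
      and "eval (\<lambda>i. eval e (\<sigma> i)) \<phi> \<in> {DB, DTop}"
    with v(3) show "eval e (Var 1) \<in> {DB, DTop}"
      unfolding \<sigma>[OF e] by blast
  qed
  then show ?thesis
    unfolding ECQ_eq by (rule explosive_closure_subset[OF L(1,2)])
qed

text \<open>Two valuations are combined in one substitution: a three-valued \<open>v\<close>
  refuting the rule, and a classical \<open>u\<close> satisfying its premises. The latter serves
  where \<open>p\<close> and \<open>q\<close> are both top: formulas in \<open>p\<close> and
  \<open>q\<close> then have classical values and cannot imitate the value b in
  \<open>v\<close>.\<close>

lemma modus_ponens_if_not_subset_join:
  assumes L: "is_logic L" "BD \<subseteq> L" "\<not> L \<subseteq> logic_join LP ECQ"
  shows "({Var 0, Disj (Neg (Var 0)) (Var 1)}, Var 1) \<in> L" (is "(?MP, _) \<in> L")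
proof -
  obtain \<Gamma> \<phi> where rule: "(\<Gamma>, \<phi>) \<in> L" "(\<Gamma>, \<phi>) \<notin> explosive_closure LP"
    using L(3) unfolding join_LP_ECQ_eq by auto
  then have "(\<Gamma>, \<phi>) \<notin> LP" and "\<nexists>\<psi>. (\<Gamma>, \<psi>) \<in> LP \<and> (\<Gamma>, Neg \<psi>) \<in> LP"
    unfolding explosive_closure_def by blast+
  then have notLP: "(\<Gamma>, \<phi>) \<notin> LP" and "classically_satisfiable \<Gamma>"
    using LP_contradiction_of_unsat by blast+
  then obtain u where u: "range u \<subseteq> {DBot, DTop}" "eval u ` \<Gamma> \<subseteq> {DTop}"
    unfolding classically_satisfiable_def by (elim exE conjE)
  from notLP obtain v where v: "range v \<subseteq> {DBot, DB, DTop}" "eval v ` \<Gamma> \<subseteq> {DB, DTop}"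
    "eval v \<phi> \<notin> {DB, DTop}"
    unfolding mem_LP by blast
  \<comment> \<open>The substituted formulas take the values of \<open>u\<close> where \<open>p = q = \<top>\<close> and the values of \<open>v\<close>
    where \<open>p = b\<close> and \<open>q\<close> is not designated. The remaining valuations that designate the premises
    of modus ponens lie above one of these in the information order.\<close>
  define \<sigma> where "\<sigma> i =
    (case v i of
       DBot \<Rightarrow> if u i = DTop then Conj (Var 0) (Var 1) else Bot
     | DTop \<Rightarrow> if u i = DTop then Top else Disj (Neg (Var 0)) (Neg (Var 1))
     | _ \<Rightarrow> if u i = DTop then Var 0 else Neg (Var 0))" for i
  have vu: "v i \<in> {DBot, DB, DTop}" "u i \<in> {DBot, DTop}" for i
    using v(1) u(1) by blast+
  have mp: "e 0 = DTop \<and> e 1 \<in> {DB, DTop} \<or> e 0 = DB" if "eval e ` ?MP \<subseteq> {DB, DTop}" for e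
    using that by (cases "e 0"; cases "e 1") (auto simp: dm4_simps)
  \<comment> \<open>For \<open>q\<close> in {bot, n}, the meet of b and \<open>q\<close> is bot and
    the join of b and the negation of \<open>q\<close> is top.\<close>
  have \<sigma>_v: "eval e (\<sigma> i) = v i" if "e 0 = DB" "e 1 \<notin> {DB, DTop}" for e i
    using that vu[of i] by (cases "e 1") (auto simp: \<sigma>_def dm4_simps)
  have \<sigma>_info: "(\<forall>i. info_le (u i) (eval e (\<sigma> i))) \<or> (\<forall>i. info_le (v i) (eval e (\<sigma> i)))"
    if e: "eval e ` ?MP \<subseteq> {DB, DTop}" for e
  proof -
    consider "e 0 = DTop" "e 1 \<in> {DB, DTop}" | "e 0 = DB" "e 1 \<notin> {DB, DTop}"
      | "e 0 = DB" "e 1 \<in> {DB, DTop}"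
      using mp[OF e] by blast
    then show ?thesis
    proof cases
      case 1
      have "info_le (u i) (eval e (\<sigma> i))" for i
        using 1 vu[of i] by (auto simp: \<sigma>_def dm4_simps info_le_def)
      then show ?thesis by blast
    next
      case 2
      then show ?thesis
        using \<sigma>_v[OF 2] by (simp add: info_le_def)
    next
      case 3
      \<comment> \<open>All nonconstant formulas used by \<sigma> have the value b here, the
        greatest in information; the constants agree with \<open>u\<close>.\<close>
      have "info_le (u i) (eval e (\<sigma> i))" for i
        using 3 vu[of i] by (auto simp: \<sigma>_def dm4_simps info_le_def)
      then show ?thesis by blast
    qed
  qed
  show ?thesis
  proof (rule derive_by_substitution[OF L(1,2) rule(1), where \<sigma> = \<sigma>])
    fix e \<gamma> assume e: "eval e ` ?MP \<subseteq> {DB, DTop}" and "\<gamma> \<in> \<Gamma>"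
    then have "eval v \<gamma> \<in> {DB, DTop}" "eval u \<gamma> \<in> {DB, DTop}"
      using v(2) u(2) by auto
    with \<sigma>_info[OF e] show "eval (\<lambda>i. eval e (\<sigma> i)) \<gamma> \<in> {DB, DTop}"
      using info_le_eval[of u "\<lambda>i. eval e (\<sigma> i)" \<gamma>] info_le_eval[of v "\<lambda>i. eval e (\<sigma> i)" \<gamma>]
        info_le_designated by blast
  next
    fix e assume e: "eval e ` ?MP \<subseteq> {DB, DTop}"
      and \<phi>: "eval (\<lambda>i. eval e (\<sigma> i)) \<phi> \<in> {DB, DTop}"
    show "eval e (Var 1) \<in> {DB, DTop}"
    proof (rule ccontr)
      assume "eval e (Var 1) \<notin> {DB, DTop}"
      then have "(\<lambda>i. eval e (\<sigma> i)) = v"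
        using mp[OF e] \<sigma>_v[of e] by auto
      with \<phi> v(3) show False
        by simp
    qed
  qed
qed

text \<open>Finitarity gives a single conjunction \<gamma> of the premises. \<open>BD\<close>
  derives \<gamma> and the disjunction of its negation with \<phi>: if \<gamma> is b, so is its
  negation; if \<gamma> is top, then \<phi> is top by \<open>ETL\<close>. Modus ponens
  finishes.\<close>

lemma ETL_subset:
  assumes L: "is_logic L" "BD \<subseteq> L"
    and mp: "({Var 0, Disj (Neg (Var 0)) (Var 1)}, Var 1) \<in> L"
  shows "ETL \<subseteq> L"
proof clarify
  fix \<Gamma> \<phi> assume "(\<Gamma>, \<phi>) \<in> ETL"
  then obtain \<Gamma>0 where \<Gamma>0: "finite \<Gamma>0" "\<Gamma>0 \<subseteq> \<Gamma>" "(\<Gamma>0, \<phi>) \<in> ETL"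
    using ETL_finitary by blast
  obtain \<gamma> where \<gamma>: "\<And>e. eval e \<gamma> \<in> {DB, DTop} \<longleftrightarrow> eval e ` \<Gamma>0 \<subseteq> {DB, DTop}"
    "\<And>e. eval e \<gamma> = DTop \<longleftrightarrow> eval e ` \<Gamma>0 \<subseteq> {DTop}"
    using finite_conjunction[OF \<Gamma>0(1)] by metis
  have "(\<Gamma>0, \<gamma>) \<in> BD"
    using \<gamma>(1) unfolding mem_BD by blast
  moreover have "(\<Gamma>0, Disj (Neg \<gamma>) \<phi>) \<in> BD"
    unfolding mem_BD
  proof (intro allI impI)
    fix e assume "eval e ` \<Gamma>0 \<subseteq> {DB, DTop}"
    then consider "eval e \<gamma> = DB" | "eval e \<gamma> = DTop"
      using \<gamma>(1) by blast
    then show "eval e (Disj (Neg \<gamma>) \<phi>) \<in> {DB, DTop}"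
    proof cases
      case 1
      then show ?thesis
        by (cases "eval e \<phi>") (auto simp: dm4_simps)
    next
      case 2
      then have "eval e \<phi> = DTop"
        using \<gamma>(2) \<Gamma>0(3) by (simp add: mem_ETL)
      then show ?thesis
        by (simp add: dm4_simps)
    qed
  qed
  moreover have "({\<gamma>, Disj (Neg \<gamma>) \<phi>}, \<phi>) \<in> L"
    using logic_subst[OF L(1) mp, of "\<lambda>i. if i = 0 then \<gamma> else \<phi>"] by simp
  ultimately have "(\<Gamma>0, \<phi>) \<in> L"
    using L(2) logic_cut[OF L(1), of "{\<gamma>, Disj (Neg \<gamma>) \<phi>}" \<Gamma>0 \<phi>] by blast
  then show "(\<Gamma>, \<phi>) \<in> L"
    using logic_mono[OF L(1)] \<Gamma>0(2) by blast
qed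

text \<open>Replacing variables by constants according to a classical counterexample makes the
  premises true and the conclusion false at every assignment, so \<open>L\<close> derives
  everything.\<close>

lemma subset_CL_if_nontrivial:
  assumes L: "is_logic L" "BD \<subseteq> L" "L \<noteq> trivial_logic"
  shows "L \<subseteq> CL"
proof (rule ccontr)
  assume "\<not> L \<subseteq> CL"
  then obtain \<Gamma> \<phi> where rule: "(\<Gamma>, \<phi>) \<in> L" "(\<Gamma>, \<phi>) \<notin> CL"
    by auto
  then obtain u where u: "range u \<subseteq> {DBot, DTop}" "eval u ` \<Gamma> \<subseteq> {DTop}" "eval u \<phi> \<noteq> DTop"
    unfolding mem_CL by blast
  have u\<phi>: "eval u \<phi> = DBot"
    using u(3) eval_in_subuniverse[OF subuniverse_CL u(1), of \<phi>] by blast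
  define \<sigma> where "\<sigma> i = (if u i = DTop then Top else Bot)" for i
  have \<sigma>: "(\<lambda>i. eval e (\<sigma> i)) = u" for e
  proof
    fix i
    have "u i \<in> {DBot, DTop}"
      using u(1) by blast
    then show "eval e (\<sigma> i) = u i"
      by (auto simp: \<sigma>_def)
  qed
  have "(\<Delta>, \<chi>) \<in> L" for \<Delta> \<chi>
    by (rule derive_by_substitution[OF L(1,2) rule(1), where \<sigma> = \<sigma>])
      (use u(2) u\<phi> in \<open>auto simp: \<sigma>\<close>)
  with L(3) show False
    by (auto simp: trivial_logic_def)
qed

section \<open>Disjointness of the intervals\<close>

lemma modus_ponens_ETL: "({Var 0, Disj (Neg (Var 0)) (Var 1)}, Var 1) \<in> ETL"
  unfolding mem_ETL
proof (intro allI impI)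
  fix e assume "eval e ` {Var 0, Disj (Neg (Var 0)) (Var 1)} \<subseteq> {DTop}"
  then show "eval e (Var 1) = DTop"
    by (cases "e 1") (auto simp: dm4_simps)
qed

lemma modus_ponens_notin_join:
  "({Var 0, Disj (Neg (Var 0)) (Var 1)}, Var 1) \<notin> logic_join LP ECQ" (is "(?MP, _) \<notin> _")
proof -
  have "(?MP, Var 1) \<notin> LP"
    unfolding mem_LP not_all
    by (intro exI[of _ "\<lambda>i. if i = 0 then DB else DBot"]) (auto simp: dm4_simps)
  moreover have "\<not> ((?MP, \<psi>) \<in> LP \<and> (?MP, Neg \<psi>) \<in> LP)" for \<psi>
  proof
    assume *: "(?MP, \<psi>) \<in> LP \<and> (?MP, Neg \<psi>) \<in> LP"
    \<comment> \<open>This classical model of the premises shows that they yield no contradictory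
      pair in \<open>LP\<close>.\<close>
    let ?e = "\<lambda>_. DTop"
    have e: "range ?e \<subseteq> {DBot, DTop}" "range ?e \<subseteq> {DBot, DB, DTop}"
      "eval ?e ` ?MP \<subseteq> {DB, DTop}"
      by (auto simp: dm4_simps)
    have "eval ?e \<psi> \<in> {DB, DTop}" "eval ?e (Neg \<psi>) \<in> {DB, DTop}"
      using * e(2,3) unfolding mem_LP by blast+
    moreover have "eval ?e \<psi> \<in> {DBot, DTop}"
      by (rule eval_in_subuniverse[OF subuniverse_CL e(1)])
    ultimately show False
      by auto
  qed
  ultimately show ?thesis
    unfolding join_LP_ECQ_eq explosive_closure_def by blast
qed

text \<open>Separates the third interval from both others, whose members all lie below
  \<open>logic_join LP ECQ\<close>.\<close>

lemma ETL_not_subset_join: "\<not> ETL \<subseteq> logic_join LP ECQ"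
  using modus_ponens_ETL modus_ponens_notin_join by blast

lemma ECQ_not_subset_LP: "\<not> ECQ \<subseteq> LP"
proof -
  have "({Var 0, Neg (Var 0)}, Var 1) \<in> ECQ"
    unfolding ECQ_eq by (rule explosion_in_explosive_closure[OF is_logic_BD])
  moreover have "({Var 0, Neg (Var 0)}, Var 1) \<notin> LP"
    unfolding mem_LP not_all
    by (intro exI[of _ "\<lambda>i. if i = 0 then DB else DBot"]) auto
  ultimately show ?thesis
    by blast
qed

theorem theorem6p9:
  shows "logic_interval (LP \<inter> ECQ) LP \<inter> logic_interval ECQ (logic_join LP ECQ) = {} \<and>
         logic_interval (LP \<inter> ECQ) LP \<inter> logic_interval ETL CL = {} \<and>
         logic_interval ECQ (logic_join LP ECQ) \<inter> logic_interval ETL CL = {} \<and>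
         (\<forall>L. is_extension BD L \<and> L \<noteq> BD \<and> L \<noteq> trivial_logic \<longrightarrow>
            L \<in> logic_interval (LP \<inter> ECQ) LP \<or>
            L \<in> logic_interval ECQ (logic_join LP ECQ) \<or>
            L \<in> logic_interval ETL CL)"
proof (intro conjI allI impI)
  have "LP \<subseteq> logic_join LP ECQ"
    unfolding logic_join_def using least_logic_upper by blast
  then show "logic_interval (LP \<inter> ECQ) LP \<inter> logic_interval ETL CL = {}"
    using ETL_not_subset_join unfolding logic_interval_def by blast
  show "logic_interval (LP \<inter> ECQ) LP \<inter> logic_interval ECQ (logic_join LP ECQ) = {}"
    using ECQ_not_subset_LP unfolding logic_interval_def by blast
  show "logic_interval ECQ (logic_join LP ECQ) \<inter> logic_interval ETL CL = {}"
    using ETL_not_subset_join unfolding logic_interval_def by blast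
next
  fix L assume "is_extension BD L \<and> L \<noteq> BD \<and> L \<noteq> trivial_logic"
  then have L: "is_logic L" "BD \<subseteq> L" "L \<noteq> BD" "L \<noteq> trivial_logic"
    by (auto simp: is_extension_def)
  \<comment> \<open>The cases are \<open>L \<subseteq> LP\<close>, \<open>L\<close> below the join
    but not below \<open>LP\<close>, and \<open>L\<close> not below the join. Each failed upper
    bound supplies the lower bound of the next interval.\<close>
  show "L \<in> logic_interval (LP \<inter> ECQ) LP \<or> L \<in> logic_interval ECQ (logic_join LP ECQ) \<or>
    L \<in> logic_interval ETL CL"
    unfolding logic_interval_def mem_Collect_eq
    using L(1) LP_Int_ECQ_subset[OF L(1,2) LP_ECQ_rule_in_proper_extension[OF L(1-3)]]
      ECQ_subset_if_not_subset_LP[OF L(1,2)]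
      ETL_subset[OF L(1,2) modus_ponens_if_not_subset_join[OF L(1,2)]]
      subset_CL_if_nontrivial[OF L(1,2,4)]
    by blast
qed

end
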